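(* Let $n\ge 1$ and, for $i=1,\dots,n$, let $-\infty\le a_i<b_i\le+\infty$ and let $f_i$ be a probability density supported on $(a_i,b_i)\subseteq\mathbb{R}$ with finite mean $m_i=\int_{a_i}^{b_i}x_i f_i(x_i)\,dx_i$. Put $A_n=\prod_{i=1}^n(a_i,b_i)$ and $f(\mathbf{x})=\prod_{i=1}^n f_i(x_i)$ for $\mathbf{x}=(x_1,\dots,x_n)\in A_n$. Suppose that for each $i=1,\dots,n$ a random variable $X_i$ distributed with density $f_i$ satisfies a weighted one-dimensional Poincaré inequality on $(a_i,b_i)$ with weight $w_i$. Then for every smooth scalar function $\phi(\mathbf{x})$, $\mathbf{x}\in A_n$, having finite variance with respect to $f$, it holds $$\int_{A_n}\left(\phi(\mathbf{x})-\int_{A_n}\phi(\mathbf{y})f(\mathbf{y})\,d\mathbf{y}\right)^2 f(\mathbf{x})\,d\mathbf{x}\;\le\;\int_{A_n}\sum_{i=1}^n w_i(x_i)\left[\frac{\partial\phi(\mathbf{x})}{\partial x_i}\right]^2 f(\mathbf{x})\,d\mathbf{x}.$$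
   Context: A random variable $X$ distributed with probability density $g$ on an interval $I\subseteq\mathbb{R}$ is said to satisfy a weighted one-dimensional Poincaré inequality on $I$ with weight $w$, where $w$ is a fixed nonnegative Borel measurable function on $I$, if for any bounded smooth scalar function $\varphi$ on $I$ $$\int_I\left(\varphi(x)-\int_I\varphi(y)g(y)\,dy\right)^2 g(x)\,dx\le\int_I w(x)\,(\varphi'(x))^2 g(x)\,dx .$$ All these inequalities are understood in the following sense: if the right-hand side is finite, then the inequality holds. *)

theory Defs
  imports "HOL-Probability.Probability"
begin

(* For open S in a Euclidean space, differentiable_upto n f S says that all directional derivatives of order at most n
   exist on S, those of order less than n are Frechet differentiable there, and those of order n
   are continuous, i.e. f is of class C^n on S. Frechet derivatives are taken in the ambient space,
   which is why S has to be open. *)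
primrec differentiable_upto ::
    "nat \<Rightarrow> ('a::real_normed_vector \<Rightarrow> real) \<Rightarrow> 'a set \<Rightarrow> bool" where
  "differentiable_upto 0 f S \<longleftrightarrow> continuous_on S f"
| "differentiable_upto (Suc n) f S \<longleftrightarrow>
     (\<forall>x\<in>S. f differentiable (at x)) \<and>
     (\<forall>v. differentiable_upto n (\<lambda>x. frechet_derivative f (at x) v) S)"

definition smooth_on :: "('a::real_normed_vector \<Rightarrow> real) \<Rightarrow> 'a set \<Rightarrow> bool" where
  "smooth_on f S \<longleftrightarrow> (\<forall>n. differentiable_upto n f S)"

definition partial_deriv :: "'n::finite \<Rightarrow> (real ^ 'n \<Rightarrow> real) \<Rightarrow> real ^ 'n \<Rightarrow> real" where
  "partial_deriv i f x = deriv (\<lambda>t. f (\<chi> j. if j = i then t else x $ j)) (x $ i)"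

definition prob_density_on :: "real set \<Rightarrow> (real \<Rightarrow> real) \<Rightarrow> bool" where
  "prob_density_on I g \<longleftrightarrow>
     g \<in> borel_measurable borel \<and> (\<forall>x. 0 \<le> g x) \<and> (\<forall>x. x \<notin> I \<longrightarrow> g x = 0) \<and>
     prob_space (density lborel (\<lambda>x. ennreal (g x)))"

(* The inequality for the law with density g, for an open interval I. The integrand on the right is
   nonnegative and measurable on I, so its set-integrability says exactly that the right-hand side
   is finite; only in that case is the inequality claimed. The left-hand side is always finite
   because phi is bounded. *)
definition weighted_poincare ::
    "real set \<Rightarrow> (real \<Rightarrow> real) \<Rightarrow> (real \<Rightarrow> real) \<Rightarrow> bool" where
  "weighted_poincare I g w \<longleftrightarrow>
     w \<in> borel_measurable (restrict_space borel I) \<and> (\<forall>x\<in>I. 0 \<le> w x) \<and>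
     (\<forall>\<phi>. smooth_on \<phi> I \<longrightarrow> bounded (\<phi> ` I) \<longrightarrow>
        set_integrable lborel I (\<lambda>x. w x * (deriv \<phi> x)\<^sup>2 * g x) \<longrightarrow>
        (LINT x:I|lborel. (\<phi> x - (LINT y:I|lborel. \<phi> y * g y))\<^sup>2 * g x)
          \<le> (LINT x:I|lborel. w x * (deriv \<phi> x)\<^sup>2 * g x))"

definition open_box :: "('n::finite \<Rightarrow> ereal) \<Rightarrow> ('n \<Rightarrow> ereal) \<Rightarrow> (real ^ 'n) set" where
  "open_box a b = {x. \<forall>i. x $ i \<in> einterval (a i) (b i)}"

definition product_density :: "('n::finite \<Rightarrow> real \<Rightarrow> real) \<Rightarrow> real ^ 'n \<Rightarrow> real" where
  "product_density f x = (\<Prod>i\<in>UNIV. f i (x $ i))"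

(* Both clauses are needed: the Bochner integral of a non-integrable function is 0 by convention. *)
definition has_finite_variance ::
    "(real ^ 'n) set \<Rightarrow> (real ^ 'n \<Rightarrow> real) \<Rightarrow> (real ^ 'n \<Rightarrow> real) \<Rightarrow> bool" where
  "has_finite_variance A p \<phi> \<longleftrightarrow>
     set_integrable lborel A (\<lambda>x. \<phi> x * p x) \<and>
     set_integrable lborel A (\<lambda>x. (\<phi> x - (LINT y:A|lborel. \<phi> y * p y))\<^sup>2 * p x)"

end

theory Submission
  imports Defs
begin

text \<open>
  Poincare inequalities pass from the factors to a product because variance is subadditive over
  independent coordinates. Let \<open>E\<^sub>i\<close> average a function over its \<open>i\<close>-th coordinate. The \<open>E\<^sub>i\<close> are
  commuting orthogonal projections in \<open>L\<^sup>2\<close>, and composing all of them yields the mean. Telescoping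
  along this composition gives the Efron-Stein inequality \<open>efron_stein\<close>: the variance of \<open>h\<close> is at most
  the sum of the squared norms of \<open>h - E\<^sub>i h\<close>. Each of these is the average, over the other
  coordinates, of the variance of \<open>h\<close> along lines parallel to axis \<open>i\<close>, and on such a line the
  weighted one-dimensional inequality applies (\<open>section_variance_le\<close>). Integrating it over all lines
  gives the term of index \<open>i\<close> on the right-hand side.

  The one-dimensional inequality is assumed for bounded functions only, and its right-hand side may be
  infinite on some lines. The second point is met by working with nonnegative integrals. For the first,
  \<open>\<phi>\<close> is replaced by \<open>k arctan (\<phi> / k)\<close>, which is smooth and bounded and whose partial derivatives are
  not larger in absolute value than those of \<open>\<phi>\<close>; as \<open>k\<close> tends to infinity, its variance tends to
  that of \<open>\<phi>\<close> (\<open>variance_le\<close>). This needs closure properties of smooth functions, and an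
  identification of the measure with density \<open>p\<close> on \<open>real ^ 'n\<close> with a product of one-dimensional laws
  (\<open>distr_vec_density\<close>).
\<close>

section \<open>Functions of class C^n\<close>

lemma differentiable_upto_cong:
  assumes "open S" "\<And>x. x \<in> S \<Longrightarrow> f x = g x" "differentiable_upto n f S"
  shows "differentiable_upto n g S"
  using assms(2,3)
proof (induction n arbitrary: f g)
  case 0
  then show ?case by (simp cong: continuous_on_cong)
next
  case (Suc n)
  have deriv: "(g has_derivative frechet_derivative f (at x)) (at x)" if "x \<in> S" for x
    using Suc.prems \<open>open S\<close> that
    by (auto simp: frechet_derivative_works
        intro: has_derivative_transform_within_open[of f _ x UNIV S g])
  have "frechet_derivative f (at x) v = frechet_derivative g (at x) v" if "x \<in> S" for x v
    using frechet_derivative_at[OF deriv[OF that]] by simp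
  then have "differentiable_upto n (\<lambda>x. frechet_derivative g (at x) v) S" for v
    using Suc.prems
    by (intro Suc.IH[of "\<lambda>x. frechet_derivative f (at x) v" "\<lambda>x. frechet_derivative g (at x) v"]) auto
  with deriv show ?case by (auto simp: differentiable_def)
qed

text \<open>The induction step of all closure properties below: a formula for the derivative that is valid
  on \<open>S\<close> can take the place of the Frechet derivative, which is only defined by choice.\<close>

lemma differentiable_upto_by_derivative:
  assumes "open S"
    and "\<And>x. x \<in> S \<Longrightarrow> (f has_derivative D x) (at x)"
    and "\<And>v. differentiable_upto n (\<lambda>x. D x v) S"
  shows "differentiable_upto (Suc n) f S"
proof -
  have "frechet_derivative f (at x) = D x" if "x \<in> S" for x
    using frechet_derivative_at[OF assms(2)[OF that]] by simp
  then have "differentiable_upto n (\<lambda>x. frechet_derivative f (at x) v) S" for v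
    by (intro differentiable_upto_cong[OF assms(1) _ assms(3)[of v]]) simp
  then show ?thesis
    using assms(2) by (auto simp: differentiable_def)
qed

lemma differentiable_upto_SucD:
  "differentiable_upto (Suc n) f S \<Longrightarrow> differentiable_upto n f S"
proof (induction n arbitrary: f)
  case 0
  then show ?case
    by (auto intro!: continuous_at_imp_continuous_on differentiable_imp_continuous_within)
next
  case (Suc n)
  then show ?case unfolding differentiable_upto.simps(2)[of "Suc n"] differentiable_upto.simps(2)[of n] by auto
qed

lemma differentiable_upto_const: "differentiable_upto n (\<lambda>_. c) S"
  by (induction n arbitrary: c) auto

lemma differentiable_upto_add:
  assumes "open S" "differentiable_upto n f S" "differentiable_upto n g S"
  shows "differentiable_upto n (\<lambda>x. f x + g x) S"
  using assms(2,3)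
proof (induction n arbitrary: f g)
  case 0
  then show ?case by (simp add: continuous_on_add)
next
  case (Suc n)
  then show ?case
    by (intro differentiable_upto_by_derivative[OF \<open>open S\<close>,
          where D = "\<lambda>x v. frechet_derivative f (at x) v + frechet_derivative g (at x) v"])
      (auto intro!: has_derivative_add simp flip: frechet_derivative_works)
qed

lemma differentiable_upto_mult:
  assumes "open S" "differentiable_upto n f S" "differentiable_upto n g S"
  shows "differentiable_upto n (\<lambda>x. f x * g x) S"
  using assms(2,3)
proof (induction n arbitrary: f g)
  case 0
  then show ?case by (simp add: continuous_on_mult)
next
  case (Suc n)
  note lower = Suc.prems[THEN differentiable_upto_SucD]
  have "differentiable_upto n
      (\<lambda>x. f x * frechet_derivative g (at x) v + frechet_derivative f (at x) v * g x) S" for v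
    using Suc lower by (intro differentiable_upto_add \<open>open S\<close> Suc.IH) auto
  with Suc.prems show ?case
    by (intro differentiable_upto_by_derivative[OF \<open>open S\<close>,
          where D = "\<lambda>x v. f x * frechet_derivative g (at x) v + frechet_derivative f (at x) v * g x"])
      (auto intro!: has_derivative_mult simp flip: frechet_derivative_works)
qed

text \<open>The derivative of \<open>1 / f\<close> is a product that contains \<open>1 / f\<close> twice, so its regularity is the
  induction hypothesis.\<close>

lemma differentiable_upto_inverse:
  assumes "open S" "\<And>x. x \<in> S \<Longrightarrow> f x \<noteq> 0" "differentiable_upto n f S"
  shows "differentiable_upto n (\<lambda>x. inverse (f x)) S"
  using assms(3)
proof (induction n)
  case 0
  then show ?case using assms(2) by (auto intro: continuous_on_inverse)
next
  case (Suc n)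
  let ?D = "\<lambda>x v. - (1::real) * (inverse (f x) * frechet_derivative f (at x) v * inverse (f x))"
  note IH = Suc.IH[OF differentiable_upto_SucD[OF Suc.prems]]
  have "differentiable_upto n (\<lambda>x. ?D x v) S" for v
    using Suc.prems by (intro differentiable_upto_mult differentiable_upto_const \<open>open S\<close> IH) auto
  moreover have "((\<lambda>x. inverse (f x)) has_derivative ?D x) (at x)" if "x \<in> S" for x
    using Deriv.has_derivative_inverse[of f x "frechet_derivative f (at x)" UNIV]
      assms(2) Suc.prems that by (auto simp flip: frechet_derivative_works)
  ultimately show ?case
    by (intro differentiable_upto_by_derivative[OF \<open>open S\<close>, where D = ?D])
qed

text \<open>The derivative of the arctangent is rational, so the closure properties above already cover it.\<close>

lemma differentiable_upto_arctan:
  assumes "open S" "differentiable_upto n f S"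
  shows "differentiable_upto n (\<lambda>x. arctan (f x)) S"
proof (cases n)
  case 0
  then show ?thesis using assms by (auto intro: continuous_on_arctan)
next
  case (Suc m)
  let ?D = "\<lambda>x v. inverse (1 + f x * f x) * frechet_derivative f (at x) v"
  have "1 + f x * f x \<noteq> 0" for x
    by (smt (verit) zero_le_square)
  then have "differentiable_upto m (\<lambda>x. ?D x v) S" for v
    using assms differentiable_upto_SucD[of m f S] unfolding Suc
    by (intro differentiable_upto_mult differentiable_upto_inverse differentiable_upto_add
        differentiable_upto_const) auto
  moreover have "((\<lambda>x. arctan (f x)) has_derivative ?D x) (at x)" if "x \<in> S" for x
  proof -
    have "(f has_derivative frechet_derivative f (at x)) (at x)"
      using assms that unfolding Suc by (auto simp flip: frechet_derivative_works)
    from DERIV_compose_FDERIV[OF DERIV_arctan this]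
    show ?thesis by (simp add: power2_eq_square mult.commute)
  qed
  ultimately show ?thesis
    unfolding Suc by (intro differentiable_upto_by_derivative[OF \<open>open S\<close>, where D = ?D])
qed

text \<open>Restricting a smooth function to a line parallel to a coordinate axis is a composition of this
  form.\<close>

lemma differentiable_upto_compose_affine:
  fixes L :: "'b::real_normed_vector \<Rightarrow> 'a::real_normed_vector"
  assumes "open T" "bounded_linear L" "\<And>t. t \<in> T \<Longrightarrow> c + L t \<in> S" "differentiable_upto n f S"
  shows "differentiable_upto n (\<lambda>t. f (c + L t)) T"
  using assms(4)
proof (induction n arbitrary: f)
  case 0
  then show ?case
    using assms(3) continuous_on_compose2[of S f T "\<lambda>t. c + L t"]
    by (auto intro: continuous_on_add[OF continuous_on_const linear_continuous_on[OF assms(2)]])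
next
  case (Suc n)
  have "((\<lambda>t. f (c + L t)) has_derivative (\<lambda>v. frechet_derivative f (at (c + L t)) (L v))) (at t)"
    if "t \<in> T" for t
  proof -
    have "(f has_derivative frechet_derivative f (at (c + L t))) (at (c + L t))"
      using Suc.prems assms(3)[OF that] by (auto simp flip: frechet_derivative_works)
    moreover have "((\<lambda>t. c + L t) has_derivative L) (at t)"
      using has_derivative_add[OF has_derivative_const bounded_linear_imp_has_derivative[OF assms(2)]]
      by simp
    ultimately show ?thesis using has_derivative_compose by blast
  qed
  moreover have "differentiable_upto n (\<lambda>t. frechet_derivative f (at (c + L t)) (L v)) T" for v
    using Suc.IH[of "\<lambda>x. frechet_derivative f (at x) (L v)"] Suc.prems by auto
  ultimately show ?case
    by (intro differentiable_upto_by_derivative[OF \<open>open T\<close>,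
        where D = "\<lambda>t v. frechet_derivative f (at (c + L t)) (L v)"])
qed

lemma frechet_derivative_real:
  "f differentiable (at x) \<Longrightarrow> frechet_derivative f (at x) 1 = deriv f x" for f :: "real \<Rightarrow> real"
  by (metis DERIV_deriv_iff_real_differentiable frechet_derivative_at has_field_derivative_def mult.right_neutral)

lemma smooth_on_differentiable: "smooth_on f S \<Longrightarrow> x \<in> S \<Longrightarrow> f differentiable (at x)"
  using differentiable_upto.simps(2) by (metis smooth_on_def)

lemma smooth_on_continuous: "smooth_on f S \<Longrightarrow> continuous_on S f"
  using differentiable_upto.simps(1) by (metis smooth_on_def)

lemma smooth_on_continuous_frechet_derivative:
  "smooth_on f S \<Longrightarrow> continuous_on S (\<lambda>x. frechet_derivative f (at x) v)"
  by (metis differentiable_upto.simps smooth_on_def)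

lemma continuous_on_deriv_smooth:
  fixes f :: "real \<Rightarrow> real"
  assumes "smooth_on f S"
  shows "continuous_on S (deriv f)"
  using smooth_on_continuous_frechet_derivative[OF assms, of 1] frechet_derivative_real
    smooth_on_differentiable[OF assms] by (simp cong: continuous_on_cong)

text \<open>The line through \<open>x\<close> in direction \<open>i\<close> is written as an affine function of the parameter, the form in
  which composition with it is covered by the chain rule.\<close>

lemma coord_line_eq: "(\<chi> j. if j = i then t else x $ j) = (x - (x $ i) *\<^sub>R axis i 1) + t *\<^sub>R axis i (1::real)"
  by (simp add: vec_eq_iff axis_def)

lemma smooth_on_coord_line:
  fixes x :: "real ^ 'n"
  assumes "smooth_on \<phi> S" "open T" "\<And>t. t \<in> T \<Longrightarrow> (\<chi> j. if j = i then t else x $ j) \<in> S"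
  shows "smooth_on (\<lambda>t. \<phi> (\<chi> j. if j = i then t else x $ j)) T"
  using assms unfolding smooth_on_def coord_line_eq
  by (auto intro!: differentiable_upto_compose_affine[where S = S] bounded_linear_scaleR_left)

lemma coord_line_has_derivative:
  fixes \<phi> :: "real ^ 'n \<Rightarrow> real"
  assumes "\<phi> differentiable (at x)"
  shows "((\<lambda>t. \<phi> (\<chi> j. if j = i then t else x $ j)) has_real_derivative
    frechet_derivative \<phi> (at x) (axis i 1)) (at (x $ i))"
proof -
  have "((\<lambda>t. x - (x $ i) *\<^sub>R axis i 1 + t *\<^sub>R axis i 1) has_derivative (\<lambda>t. t *\<^sub>R axis i 1)) (at (x $ i))"
    by (auto intro!: derivative_eq_intros)
  moreover have "(\<phi> has_derivative frechet_derivative \<phi> (at x))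
      (at (x - (x $ i) *\<^sub>R axis i 1 + (x $ i) *\<^sub>R axis i 1))"
    using assms by (simp add: frechet_derivative_works)
  ultimately have "((\<lambda>t. \<phi> (x - (x $ i) *\<^sub>R axis i 1 + t *\<^sub>R axis i 1)) has_derivative
      (\<lambda>t. frechet_derivative \<phi> (at x) (t *\<^sub>R axis i 1))) (at (x $ i))"
    by (rule has_derivative_compose)
  moreover have "linear (frechet_derivative \<phi> (at x))"
    using assms by (rule linear_frechet_derivative)
  ultimately show ?thesis
    unfolding coord_line_eq has_field_derivative_def by (simp add: linear_cmul mult_commute_abs)
qed

lemma partial_deriv_eq_frechet:
  "\<phi> differentiable (at x) \<Longrightarrow> partial_deriv i \<phi> x = frechet_derivative \<phi> (at x) (axis i 1)"
  unfolding partial_deriv_def by (rule DERIV_imp_deriv[OF coord_line_has_derivative])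

section \<open>Smooth truncation\<close>

text \<open>A smooth truncation at level of order \<open>c\<close>: it is bounded, has a derivative between \<open>0\<close> and \<open>1\<close>, and
  tends to the identity as \<open>c\<close> grows. The bound on the derivative is what makes truncation decrease
  the right-hand side of a Poincare inequality.\<close>

definition soft_cut :: "real \<Rightarrow> real \<Rightarrow> real" where
  "soft_cut c u = c * arctan (u / c)"

lemma abs_soft_cut_le: "0 < c \<Longrightarrow> \<bar>soft_cut c u\<bar> \<le> \<bar>u\<bar>"
  using mult_left_mono[OF abs_arctan_le[of "u / c"], of c] by (simp add: soft_cut_def abs_mult)

lemma abs_soft_cut_bounded: "0 < c \<Longrightarrow> \<bar>soft_cut c u\<bar> \<le> c * (pi / 2)"
  using arctan_bounded[of "u / c"] by (auto simp: soft_cut_def abs_mult intro!: mult_left_mono)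

lemma soft_cut_tendsto: "(\<lambda>k. soft_cut (real (Suc k)) u) \<longlonglongrightarrow> u"
proof (cases "u = 0")
  case False
  \<comment> \<open>The difference quotient of the arctangent at \<open>0\<close>.\<close>
  have "((\<lambda>h :: real. arctan h / h) \<longlongrightarrow> 1) (at 0)"
    using DERIV_arctan[of 0] by (simp add: DERIV_def)
  moreover have "filterlim (\<lambda>k. u / real (Suc k)) (at 0) sequentially"
    using False LIMSEQ_Suc[OF lim_const_over_n[of u]] by (auto simp: filterlim_at)
  ultimately have "(\<lambda>k. u * (arctan (u / real (Suc k)) / (u / real (Suc k)))) \<longlonglongrightarrow> u * 1"
    by (intro tendsto_intros) (rule filterlim_compose)
  moreover have "u * (arctan (u / c) / (u / c)) = soft_cut c u" if "c \<noteq> 0" for c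
    using False that by (simp add: soft_cut_def)
  ultimately show ?thesis by simp
qed (simp add: soft_cut_def)

lemma soft_cut_has_derivative:
  assumes "0 < c"
  shows "(soft_cut c has_real_derivative inverse (1 + (u / c)\<^sup>2)) (at u)"
proof -
  have "((\<lambda>u. c * arctan (u / c)) has_real_derivative c * (inverse (1 + (u / c)\<^sup>2) * (1 / c))) (at u)"
    by (intro DERIV_cmult DERIV_chain2[OF DERIV_arctan] DERIV_cdivide DERIV_ident)
  with assms show ?thesis by (simp add: soft_cut_def[abs_def])
qed

lemma smooth_on_soft_cut:
  assumes "open S" "smooth_on \<phi> S"
  shows "smooth_on (\<lambda>x. soft_cut c (\<phi> x)) S"
  using assms unfolding smooth_on_def soft_cut_def divide_inverse
  by (auto intro!: differentiable_upto_mult differentiable_upto_arctan differentiable_upto_const)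

lemma abs_partial_deriv_soft_cut_le:
  assumes "0 < c" "\<phi> differentiable (at x)"
  shows "\<bar>partial_deriv i (\<lambda>x. soft_cut c (\<phi> x)) x\<bar> \<le> \<bar>partial_deriv i \<phi> x\<bar>"
proof -
  let ?l = "\<lambda>t. (\<chi> j. if j = i then t else x $ j)"
  have "?l (x $ i) = x" by (simp add: vec_eq_iff)
  then have "partial_deriv i (\<lambda>x. soft_cut c (\<phi> x)) x = inverse (1 + (\<phi> x / c)\<^sup>2) * partial_deriv i \<phi> x"
    unfolding partial_deriv_eq_frechet[OF assms(2)] partial_deriv_def[of i "\<lambda>x. soft_cut c (\<phi> x)"]
    using DERIV_chain2[OF soft_cut_has_derivative[OF assms(1)] coord_line_has_derivative[OF assms(2)], of i]
    by (auto intro!: DERIV_imp_deriv)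
  moreover have "\<bar>inverse (1 + (\<phi> x / c)\<^sup>2)\<bar> \<le> 1"
    by (simp add: abs_inverse inverse_le_1_iff)
  ultimately show ?thesis
    by (simp add: abs_mult mult_left_le_one_le)
qed

section \<open>The Efron-Stein inequality\<close>

context finite_product_prob_space
begin

abbreviation \<P> :: "('a \<Rightarrow> 'b) measure" where "\<P> \<equiv> Pi\<^sub>M I M"

lemma fun_upd_in_space:
  "i \<in> I \<Longrightarrow> x \<in> space \<P> \<Longrightarrow> t \<in> space (M i) \<Longrightarrow> x(i := t) \<in> space \<P>"
  by (auto simp: space_PiM PiE_def extensional_def)

lemma measurable_resample [measurable]:
  "i \<in> I \<Longrightarrow> (\<lambda>(x, t). x(i := t)) \<in> \<P> \<Otimes>\<^sub>M M i \<rightarrow>\<^sub>M \<P>"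
  using measurable_add_dim[of i I M] by (simp add: insert_absorb)

lemma measurable_section:
  assumes "i \<in> I" "x \<in> space \<P>"
  shows "(\<lambda>t. x(i := t)) \<in> M i \<rightarrow>\<^sub>M \<P>"
  using measurable_compose[OF measurable_Pair1'[OF assms(2)] measurable_resample[OF assms(1)]]
  by simp

text \<open>Replacing one coordinate by an independent copy does not change the law of the point. This is the
  form in which Fubini's theorem enters the statements about averages over one coordinate.\<close>

lemma distr_resample:
  assumes "i \<in> I"
  shows "distr (\<P> \<Otimes>\<^sub>M M i) \<P> (\<lambda>(x, t). x(i := t)) = \<P>"
proof (rule PiM_eqI)
  fix A assume A: "\<And>i. i \<in> I \<Longrightarrow> A i \<in> sets (M i)"
  define B where "B = A(i := space (M i))"
  have B: "B j \<in> sets (M j)" if "j \<in> I" for j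
    using A that by (auto simp: B_def)
  have "(\<lambda>(x, t). x(i := t)) -` Pi\<^sub>E I A \<inter> space (\<P> \<Otimes>\<^sub>M M i) = Pi\<^sub>E I B \<times> A i"
    using assms B[THEN sets.sets_into_space] A[THEN sets.sets_into_space]
    by (fastforce simp: space_pair_measure space_PiM B_def PiE_iff extensional_def split: if_splits)
  then have "emeasure (distr (\<P> \<Otimes>\<^sub>M M i) \<P> (\<lambda>(x, t). x(i := t))) (Pi\<^sub>E I A)
      = emeasure \<P> (Pi\<^sub>E I B) * emeasure (M i) (A i)"
    using A B assms finite_index
      M.emeasure_pair_measure_Times[of "Pi\<^sub>E I B" \<P> "A i" i]
    by (subst emeasure_distr[OF measurable_resample]) (auto intro!: sets_PiM_I_finite)
  also have "emeasure \<P> (Pi\<^sub>E I B) = (\<Prod>j\<in>I. emeasure (M j) (B j))"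
    by (rule emeasure_PiM[OF finite_index B])
  also have "\<dots> = (\<Prod>j\<in>I - {i}. emeasure (M j) (A j))"
    using assms by (auto simp: prod.remove[OF finite_index] B_def M.emeasure_space_1 intro!: prod.cong)
  finally show "emeasure (distr (\<P> \<Otimes>\<^sub>M M i) \<P> (\<lambda>(x, t). x(i := t))) (Pi\<^sub>E I A)
      = (\<Prod>j\<in>I. emeasure (M j) (A j))"
    using assms by (simp add: prod.remove[OF finite_index] mult.commute del: fun_upd_apply)
qed (use finite_index in auto)

lemma nn_integral_resample:
  assumes "i \<in> I" and [measurable]: "G \<in> borel_measurable \<P>"
  shows "(\<integral>\<^sup>+ x. G x \<partial>\<P>) = (\<integral>\<^sup>+ x. \<integral>\<^sup>+ t. G (x(i := t)) \<partial>M i \<partial>\<P>)"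
proof -
  note [measurable] = measurable_resample[OF assms(1)]
  have "(\<integral>\<^sup>+ x. G x \<partial>\<P>) = (\<integral>\<^sup>+ z. G (case z of (x, t) \<Rightarrow> x(i := t)) \<partial>(\<P> \<Otimes>\<^sub>M M i))"
    by (subst distr_resample[OF assms(1), symmetric]) (simp add: nn_integral_distr)
  also have "\<dots> = (\<integral>\<^sup>+ x. \<integral>\<^sup>+ t. G (x(i := t)) \<partial>M i \<partial>\<P>)"
    by (subst M.nn_integral_fst[symmetric]) auto
  finally show ?thesis .
qed

text \<open>Boundedness is required everywhere and not almost everywhere, so that all sections of a bounded
  random variable are integrable without exceptional null sets.\<close>

definition bounded_rv :: "(('a \<Rightarrow> 'b) \<Rightarrow> real) \<Rightarrow> bool" where
  "bounded_rv h \<longleftrightarrow> h \<in> borel_measurable \<P> \<and> bounded (h ` space \<P>)"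

text \<open>The conditional expectation given all coordinates except the \<open>i\<close>-th, in the version that is
  defined at every point.\<close>

definition coord_mean :: "'a \<Rightarrow> (('a \<Rightarrow> 'b) \<Rightarrow> real) \<Rightarrow> ('a \<Rightarrow> 'b) \<Rightarrow> real" where
  "coord_mean i h x = (\<integral>t. h (x(i := t)) \<partial>M i)"

lemma bounded_rvD: "bounded_rv h \<Longrightarrow> h \<in> borel_measurable \<P>"
  by (simp add: bounded_rv_def)

lemma bounded_rvE:
  assumes "bounded_rv h"
  obtains C where "\<And>x. x \<in> space \<P> \<Longrightarrow> \<bar>h x\<bar> \<le> C"
  using assms by (auto simp: bounded_rv_def bounded_iff)

lemma bounded_rvI:
  "h \<in> borel_measurable \<P> \<Longrightarrow> (\<And>x. x \<in> space \<P> \<Longrightarrow> \<bar>h x\<bar> \<le> C) \<Longrightarrow> bounded_rv h"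
  by (auto simp: bounded_rv_def bounded_iff)

lemma bounded_rv_diff:
  assumes "bounded_rv g" "bounded_rv h"
  shows "bounded_rv (\<lambda>x. g x - h x)"
proof -
  obtain C D where "\<And>x. x \<in> space \<P> \<Longrightarrow> \<bar>g x\<bar> \<le> C" "\<And>x. x \<in> space \<P> \<Longrightarrow> \<bar>h x\<bar> \<le> D"
    using assms by (metis bounded_rvE)
  with assms[THEN bounded_rvD] show ?thesis
    by (intro bounded_rvI[of _ "C + D"]) (auto intro: order_trans[OF abs_triangle_ineq4] add_mono)
qed

lemma bounded_rv_mult:
  assumes "bounded_rv g" "bounded_rv h"
  shows "bounded_rv (\<lambda>x. g x * h x)"
proof -
  obtain C D where "\<And>x. x \<in> space \<P> \<Longrightarrow> \<bar>g x\<bar> \<le> C" "\<And>x. x \<in> space \<P> \<Longrightarrow> \<bar>h x\<bar> \<le> D"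
    using assms by (metis bounded_rvE)
  with assms[THEN bounded_rvD] show ?thesis
    by (intro bounded_rvI[of _ "C * D"]) (auto simp: abs_mult intro!: mult_mono')
qed

lemma integrable_bounded_rv: "bounded_rv h \<Longrightarrow> integrable \<P> h"
  by (rule bounded_rvE, assumption, rule integrable_const_bound[OF AE_I2]) (auto dest: bounded_rvD)

lemma integrable_section:
  assumes "i \<in> I" "x \<in> space \<P>" "bounded_rv h"
  shows "integrable (M i) (\<lambda>t. h (x(i := t)))"
proof -
  have *: "(\<lambda>t. h (x(i := t))) \<in> borel_measurable (M i)"
    by (rule measurable_compose[OF measurable_section[OF assms(1,2)] bounded_rvD[OF assms(3)]])
  obtain C where "\<And>x. x \<in> space \<P> \<Longrightarrow> \<bar>h x\<bar> \<le> C"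
    using assms(3) by (metis bounded_rvE)
  then show "integrable (M i) (\<lambda>t. h (x(i := t)))"
    using assms by (intro M.integrable_const_bound[OF _ *, of C] AE_I2) (auto intro: fun_upd_in_space)
qed

lemma bounded_rv_coord_mean:
  assumes "i \<in> I" "bounded_rv h"
  shows "bounded_rv (coord_mean i h)"
proof -
  obtain C where C: "\<And>x. x \<in> space \<P> \<Longrightarrow> \<bar>h x\<bar> \<le> C"
    using assms(2) by (metis bounded_rvE)
  have "(\<lambda>(x, t). h (x(i := t))) \<in> borel_measurable (\<P> \<Otimes>\<^sub>M M i)"
    using measurable_compose[OF measurable_resample[OF assms(1)] bounded_rvD[OF assms(2)]]
    by (simp add: case_prod_unfold)
  then have "coord_mean i h \<in> borel_measurable \<P>"
    unfolding coord_mean_def by (rule M.borel_measurable_lebesgue_integral)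
  moreover have "\<bar>coord_mean i h x\<bar> \<le> C" if "x \<in> space \<P>" for x
  proof -
    have "\<bar>coord_mean i h x\<bar> \<le> (\<integral>t. \<bar>h (x(i := t))\<bar> \<partial>M i)"
      unfolding coord_mean_def by (rule integral_abs_bound)
    also have "\<dots> \<le> (\<integral>t. C \<partial>M i)"
      using integrable_section[OF assms(1) that assms(2)] that assms(1)
      by (intro integral_mono) (auto intro!: C fun_upd_in_space simp del: fun_upd_apply)
    finally show ?thesis by (simp add: M.prob_space)
  qed
  ultimately show ?thesis by (rule bounded_rvI)
qed

lemma integral_coord_mean:
  assumes "i \<in> I" "bounded_rv h"
  shows "(\<integral>x. coord_mean i h x \<partial>\<P>) = (\<integral>x. h x \<partial>\<P>)"
proof -
  note [measurable] = measurable_resample[OF assms(1)] bounded_rvD[OF assms(2)]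
  interpret Q: pair_sigma_finite \<P> "M i" ..
  let ?h = "\<lambda>z. h (case z of (x, t) \<Rightarrow> x(i := t))"
  have "integrable \<P> h" by (rule integrable_bounded_rv[OF assms(2)])
  then have int: "integrable (\<P> \<Otimes>\<^sub>M M i) ?h"
    by (subst (asm) distr_resample[OF assms(1), symmetric]) (simp add: integrable_distr_eq)
  have "(\<integral>x. h x \<partial>\<P>) = (\<integral>z. ?h z \<partial>(\<P> \<Otimes>\<^sub>M M i))"
    by (subst distr_resample[OF assms(1), symmetric]) (simp add: integral_distr)
  also have "\<dots> = (\<integral>x. coord_mean i h x \<partial>\<P>)"
    unfolding coord_mean_def using Q.integral_fst'[OF int] by simp
  finally show ?thesis by simp
qed

lemma coord_mean_diff:
  assumes "i \<in> I" "x \<in> space \<P>" "bounded_rv g" "bounded_rv h"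
  shows "coord_mean i (\<lambda>x. g x - h x) x = coord_mean i g x - coord_mean i h x"
  unfolding coord_mean_def
  using integrable_section[OF assms(1,2)] assms(3,4) by (intro Bochner_Integration.integral_diff)

lemma coord_mean_cong:
  assumes "i \<in> I" "x \<in> space \<P>" "\<And>x. x \<in> space \<P> \<Longrightarrow> g x = h x"
  shows "coord_mean i g x = coord_mean i h x"
  unfolding coord_mean_def
  using assms by (intro Bochner_Integration.integral_cong) (auto intro!: fun_upd_in_space)

lemma coord_mean_commute:
  assumes "i \<in> I" "j \<in> I" "x \<in> space \<P>" "bounded_rv h"
  shows "coord_mean i (coord_mean j h) x = coord_mean j (coord_mean i h) x"
proof (cases "i = j")
  case False
  interpret Q: pair_prob_space "M i" "M j" ..
  obtain C where C: "\<And>x. x \<in> space \<P> \<Longrightarrow> \<bar>h x\<bar> \<le> C"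
    using assms(4) by (metis bounded_rvE)
  have "(\<lambda>z. x(i := fst z)) \<in> M i \<Otimes>\<^sub>M M j \<rightarrow>\<^sub>M \<P>"
    using measurable_compose[OF measurable_fst measurable_section[OF assms(1,3)]] .
  then have "(\<lambda>z. (x(i := fst z), snd z)) \<in> M i \<Otimes>\<^sub>M M j \<rightarrow>\<^sub>M \<P> \<Otimes>\<^sub>M M j"
    by (intro measurable_Pair measurable_snd)
  from measurable_compose[OF measurable_compose[OF this measurable_resample[OF assms(2)]]
      bounded_rvD[OF assms(4)]]
  have m: "(\<lambda>(s, t). h (x(i := s, j := t))) \<in> borel_measurable (M i \<Otimes>\<^sub>M M j)"
    by (simp add: case_prod_unfold)
  have "integrable (M i \<Otimes>\<^sub>M M j) (\<lambda>(s, t). h (x(i := s, j := t)))"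
    using assms(1-3)
    by (intro Q.integrable_const_bound[OF _ m, of C] AE_I2)
      (auto simp: space_pair_measure intro!: C fun_upd_in_space simp del: fun_upd_apply)
  from Q.Fubini_integral[OF this] show ?thesis
    using False by (simp add: coord_mean_def fun_upd_twist)
qed simp

text \<open>\<open>coord_mean i\<close> is an orthogonal projection in \<open>L\<^sup>2\<close>, because \<open>coord_mean i h\<close> is constant along
  the \<open>i\<close>-th coordinate and can be pulled out of an average over it.\<close>

lemma coord_mean_pythagoras:
  assumes "i \<in> I" "bounded_rv h"
  shows "(\<integral>x. (h x - coord_mean i h x)\<^sup>2 \<partial>\<P>)
    = (\<integral>x. (h x)\<^sup>2 \<partial>\<P>) - (\<integral>x. (coord_mean i h x)\<^sup>2 \<partial>\<P>)"
proof -
  note m = bounded_rv_coord_mean[OF assms]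
  note hm = bounded_rv_mult[OF assms(2) m]
  have "coord_mean i (\<lambda>x. h x * coord_mean i h x) x = (coord_mean i h x)\<^sup>2" for x
    by (simp add: coord_mean_def power2_eq_square)
  with integral_coord_mean[OF assms(1) hm]
  have "(\<integral>x. h x * coord_mean i h x \<partial>\<P>) = (\<integral>x. (coord_mean i h x)\<^sup>2 \<partial>\<P>)"
    by simp
  moreover have "(\<integral>x. (h x - coord_mean i h x)\<^sup>2 \<partial>\<P>)
    = (\<integral>x. (h x)\<^sup>2 + (coord_mean i h x)\<^sup>2 - 2 * (h x * coord_mean i h x) \<partial>\<P>)"
    by (simp add: power2_diff mult.assoc)
  ultimately show ?thesis
    using hm bounded_rv_mult[OF m m] bounded_rv_mult[OF assms(2,2)]
    by (simp add: power2_eq_square integrable_bounded_rv)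
qed

abbreviation coord_means :: "'a list \<Rightarrow> (('a \<Rightarrow> 'b) \<Rightarrow> real) \<Rightarrow> ('a \<Rightarrow> 'b) \<Rightarrow> real" where
  "coord_means xs h \<equiv> foldr coord_mean xs h"

lemma bounded_rv_coord_means:
  "set xs \<subseteq> I \<Longrightarrow> bounded_rv h \<Longrightarrow> bounded_rv (coord_means xs h)"
  by (induction xs) (auto intro: bounded_rv_coord_mean)

lemma integral_coord_means:
  "set xs \<subseteq> I \<Longrightarrow> bounded_rv h \<Longrightarrow> (\<integral>x. coord_means xs h x \<partial>\<P>) = (\<integral>x. h x \<partial>\<P>)"
  by (induction xs) (auto simp: integral_coord_mean bounded_rv_coord_means)

lemma coord_means_contraction:
  assumes "set xs \<subseteq> I" "bounded_rv h"
  shows "(\<integral>x. (coord_means xs h x)\<^sup>2 \<partial>\<P>) \<le> (\<integral>x. (h x)\<^sup>2 \<partial>\<P>)"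
  using assms(1)
proof (induction xs)
  case (Cons i xs)
  then have b: "bounded_rv (coord_means xs h)" and "i \<in> I"
    using bounded_rv_coord_means assms by auto
  from coord_mean_pythagoras[OF this(2,1)]
  have "(\<integral>x. (coord_means (i # xs) h x)\<^sup>2 \<partial>\<P>) \<le> (\<integral>x. (coord_means xs h x)\<^sup>2 \<partial>\<P>)"
    using integral_nonneg_AE[of "\<lambda>x. (coord_means xs h x - coord_mean i (coord_means xs h) x)\<^sup>2" \<P>]
    by simp
  with Cons show ?case by simp
qed simp

text \<open>The averages over different coordinates commute with each other and are linear, so a projection
  error can be moved inside the previous averages.\<close>

lemma coord_means_diff_coord_mean:
  assumes "set xs \<subseteq> I" "i \<in> I" "bounded_rv h" "x \<in> space \<P>"
  shows "coord_means xs (\<lambda>y. h y - coord_mean i h y) x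
    = coord_means xs h x - coord_mean i (coord_means xs h) x"
  using assms(1,4)
proof (induction xs arbitrary: x)
  case (Cons j xs)
  then have b: "bounded_rv (coord_means xs h)" and j: "j \<in> I"
    using bounded_rv_coord_means assms by auto
  have "coord_means (j # xs) (\<lambda>y. h y - coord_mean i h y) x
      = coord_mean j (\<lambda>y. coord_means xs h y - coord_mean i (coord_means xs h) y) x"
    using Cons j by (auto intro!: coord_mean_cong)
  also have "\<dots> = coord_means (j # xs) h x - coord_mean j (coord_mean i (coord_means xs h)) x"
    using Cons.prems j b assms(2) by (simp add: coord_mean_diff bounded_rv_coord_mean)
  finally show ?case
    using coord_mean_commute[OF j assms(2) Cons.prems(2) b] by simp
qed simp

lemma coord_means_depend:
  assumes "set xs \<subseteq> I" "x \<in> space \<P>" "y \<in> space \<P>" "\<And>i. i \<notin> set xs \<Longrightarrow> x i = y i"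
  shows "coord_means xs h x = coord_means xs h y"
  using assms
proof (induction xs arbitrary: x y)
  case Nil
  then have "x = y" by auto
  then show ?case by simp
next
  case (Cons i xs)
  have "coord_means xs h (x(i := t)) = coord_means xs h (y(i := t))" if "t \<in> space (M i)" for t
    using Cons.prems that by (intro Cons.IH fun_upd_in_space) auto
  then show ?case
    unfolding coord_mean_def foldr_Cons o_apply by (intro Bochner_Integration.integral_cong) auto
qed

text \<open>Averaging out the coordinates one at a time leads from \<open>h\<close> to its mean, and by orthogonality the
  variance is the sum of the squared errors of the steps. The error of the step for coordinate \<open>i\<close> is
  the image of \<open>h - coord_mean i h\<close> under the averages already taken, which are contractions. So it is
  at most the error that coordinate \<open>i\<close> causes when it is averaged out first.\<close>

theorem efron_stein:
  assumes h: "bounded_rv h"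
  shows "(\<integral>x. (h x)\<^sup>2 \<partial>\<P>) - (\<integral>x. h x \<partial>\<P>)\<^sup>2
    \<le> (\<Sum>i\<in>I. \<integral>x. (h x - coord_mean i h x)\<^sup>2 \<partial>\<P>)"
proof -
  have telescope: "(\<integral>x. (h x)\<^sup>2 \<partial>\<P>) \<le> (\<integral>x. (coord_means xs h x)\<^sup>2 \<partial>\<P>)
      + (\<Sum>i\<leftarrow>xs. \<integral>x. (h x - coord_mean i h x)\<^sup>2 \<partial>\<P>)" if "set xs \<subseteq> I" for xs
    using that
  proof (induction xs)
    case (Cons i xs)
    then have b: "bounded_rv (coord_means xs h)" and i: "i \<in> I" and xs: "set xs \<subseteq> I"
      using bounded_rv_coord_means h by auto
    have "(\<integral>x. (coord_means xs h x)\<^sup>2 \<partial>\<P>) - (\<integral>x. (coord_means (i # xs) h x)\<^sup>2 \<partial>\<P>)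
        = (\<integral>x. (coord_means xs h x - coord_mean i (coord_means xs h) x)\<^sup>2 \<partial>\<P>)"
      using coord_mean_pythagoras[OF i b] by simp
    also have "\<dots> = (\<integral>x. (coord_means xs (\<lambda>y. h y - coord_mean i h y) x)\<^sup>2 \<partial>\<P>)"
      using coord_means_diff_coord_mean[OF xs i h]
      by (intro Bochner_Integration.integral_cong) auto
    also have "\<dots> \<le> (\<integral>x. (h x - coord_mean i h x)\<^sup>2 \<partial>\<P>)"
      using xs i h by (intro coord_means_contraction bounded_rv_diff bounded_rv_coord_mean)
    finally show ?case using Cons.IH[OF xs] by simp
  qed simp
  obtain xs where xs: "set xs = I" "distinct xs"
    using finite_distinct_list[OF finite_index] by auto
  obtain x0 where x0: "x0 \<in> space \<P>" using not_empty by blast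
  \<comment> \<open>Once every coordinate has been averaged out, the function is constant, equal to the mean.\<close>
  have const: "coord_means xs h x = coord_means xs h x0" if "x \<in> space \<P>" for x
    using xs that x0
    by (intro coord_means_depend) (auto simp: space_PiM PiE_def extensional_def)
  have int_const: "(\<integral>x. F (coord_means xs h x) \<partial>\<P>) = F (coord_means xs h x0)" for F :: "real \<Rightarrow> real"
  proof -
    have "(\<integral>x. F (coord_means xs h x) \<partial>\<P>) = (\<integral>x. F (coord_means xs h x0) \<partial>\<P>)"
      using const by (intro Bochner_Integration.integral_cong) auto
    then show ?thesis by (simp add: P.prob_space)
  qed
  have "(\<integral>x. (coord_means xs h x)\<^sup>2 \<partial>\<P>) = (\<integral>x. h x \<partial>\<P>)\<^sup>2"
    using integral_coord_means[of xs h] int_const[of "\<lambda>u. u"] int_const[of "\<lambda>u. u\<^sup>2"] xs h by simp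
  with telescope[of xs] xs show ?thesis
    by (simp add: sum_list_distinct_conv_sum_set)
qed

end

section \<open>Product densities on Euclidean space\<close>

lemma Basis_real_vec: "(Basis :: (real ^ 'n) set) = range (\<lambda>i. axis i 1)"
  by (auto simp: Basis_vec_def)

lemma measurable_vec_lambda:
  assumes "\<And>i. sets (M i) = sets borel"
  shows "(\<lambda>y. \<chi> i. y i) \<in> (\<Pi>\<^sub>M i\<in>UNIV. M i) \<rightarrow>\<^sub>M (borel :: (real ^ 'n) measure)"
proof -
  have vec: "(\<chi> i. y i) = (\<Sum>i\<in>UNIV. y i *\<^sub>R axis i (1::real))" for y :: "'n \<Rightarrow> real"
    by (simp add: vec_eq_iff axis_def if_distrib cong: if_cong)
  have "(\<lambda>y. y i) \<in> (\<Pi>\<^sub>M i\<in>UNIV. M i) \<rightarrow>\<^sub>M borel" for i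
    using measurable_component_singleton[of i UNIV M, unfolded measurable_cong_sets[OF refl assms[of i]]]
    by simp
  then show ?thesis
    unfolding vec by (intro borel_measurable_sum borel_measurable_scaleR) auto
qed

text \<open>Lebesgue measure on \<open>real ^ 'n\<close> and the product of the one-dimensional Lebesgue measures live on
  different types; the two are linked by their values on boxes.\<close>

lemma distr_vec_lborel:
  "distr (\<Pi>\<^sub>M i\<in>UNIV. lborel) borel (\<lambda>y. \<chi> i. y i) = (lborel :: (real ^ 'n) measure)"
proof (rule lborel_eqI[symmetric])
  interpret product_sigma_finite "\<lambda>_ :: 'n. lborel :: real measure" ..
  fix l u :: "real ^ 'n"
  assume "\<And>b. b \<in> Basis \<Longrightarrow> l \<bullet> b \<le> u \<bullet> b"
  from this[of "axis i 1" for i] have le: "l $ i \<le> u $ i" for i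
    by (simp add: inner_axis)
  let ?V = "\<lambda>y :: 'n \<Rightarrow> real. (\<chi> i. y i) :: real ^ 'n"
  have "?V -` box l u \<inter> space (\<Pi>\<^sub>M i\<in>UNIV. lborel) = (\<Pi>\<^sub>E i\<in>UNIV. {l $ i <..< u $ i})"
    by (auto simp: mem_box Basis_real_vec inner_axis space_PiM PiE_iff)
  then have "emeasure (distr (\<Pi>\<^sub>M i\<in>UNIV. lborel) borel ?V) (box l u)
      = (\<Prod>i\<in>UNIV. emeasure lborel {l $ i <..< u $ i})"
    by (subst emeasure_distr[OF measurable_vec_lambda]) (auto simp: emeasure_PiM)
  also have "\<dots> = (\<Prod>i\<in>UNIV. (u - l) $ i)"
    using le by (simp add: prod_ennreal)
  also have "(\<Prod>i\<in>UNIV. (u - l) $ i) = (\<Prod>b\<in>Basis. (u - l) \<bullet> b)"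
    unfolding Basis_real_vec by (subst prod.reindex) (auto simp: inj_on_def axis_eq_axis inner_axis)
  finally show "emeasure (distr (\<Pi>\<^sub>M i\<in>UNIV. lborel) borel ?V) (box l u) = (\<Prod>b\<in>Basis. (u - l) \<bullet> b)" .
qed simp

lemma distr_vec_density:
  fixes g :: "'n::finite \<Rightarrow> real \<Rightarrow> ennreal"
  assumes [measurable]: "\<And>i. g i \<in> borel_measurable borel"
    and sf: "\<And>i. sigma_finite_measure (density lborel (g i))"
  shows "distr (\<Pi>\<^sub>M i\<in>UNIV. density lborel (g i)) borel (\<lambda>y. \<chi> i. y i)
    = density lborel (\<lambda>x :: real ^ 'n. \<Prod>i\<in>UNIV. g i (x $ i))"
proof -
  interpret L: product_sigma_finite "\<lambda>_ :: 'n. lborel :: real measure" ..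
  interpret D: product_sigma_finite "\<lambda>i. density lborel (g i)"
    using sf by (simp add: product_sigma_finite_def)
  let ?L = "\<Pi>\<^sub>M i\<in>(UNIV :: 'n set). (lborel :: real measure)"
  have "density ?L (\<lambda>y. \<Prod>i\<in>UNIV. g i (y i)) = (\<Pi>\<^sub>M i\<in>UNIV. density lborel (g i))"
  proof (rule D.PiM_eqI)
    show "sets (density ?L (\<lambda>y. \<Prod>i\<in>UNIV. g i (y i))) = sets (\<Pi>\<^sub>M i\<in>UNIV. density lborel (g i))"
      by (simp cong: sets_PiM_cong)
    fix A :: "'n \<Rightarrow> real set"
    assume "\<And>i. i \<in> UNIV \<Longrightarrow> A i \<in> sets (density lborel (g i))"
    then have [measurable]: "A i \<in> sets borel" for i by simp
    have ind: "(\<Prod>i\<in>UNIV. g i (y i)) * indicator (Pi\<^sub>E UNIV A) y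
        = (\<Prod>i\<in>UNIV. g i (y i) * indicator (A i) (y i))" for y
      by (auto simp: indicator_def prod.distrib PiE_iff)
    have "emeasure (density ?L (\<lambda>y. \<Prod>i\<in>UNIV. g i (y i))) (Pi\<^sub>E UNIV A)
        = (\<integral>\<^sup>+ y. (\<Prod>i\<in>UNIV. g i (y i) * indicator (A i) (y i)) \<partial>?L)"
      by (subst emeasure_density) (auto simp: ind intro!: sets_PiM_I_finite)
    also have "\<dots> = (\<Prod>i\<in>UNIV. emeasure (density lborel (g i)) (A i))"
      by (subst L.product_nn_integral_prod) (auto simp: emeasure_density)
    finally show "emeasure (density ?L (\<lambda>y. \<Prod>i\<in>UNIV. g i (y i))) (Pi\<^sub>E UNIV A)
      = (\<Prod>i\<in>UNIV. emeasure (density lborel (g i)) (A i))" .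
  qed simp
  moreover have "density (distr ?L borel (\<lambda>y. \<chi> i. y i)) (\<lambda>x :: real ^ 'n. \<Prod>i\<in>UNIV. g i (x $ i))
      = distr (density ?L (\<lambda>y. \<Prod>i\<in>UNIV. g i ((\<chi> i. y i) $ i))) borel (\<lambda>y. \<chi> i. y i)"
    by (rule density_distr[OF _ measurable_vec_lambda]) auto
  ultimately show ?thesis
    by (simp add: distr_vec_lborel)
qed

section \<open>Tensorization of weighted Poincare inequalities\<close>

locale poincare_product =
  fixes a b :: "'n::finite \<Rightarrow> ereal" and f w :: "'n \<Rightarrow> real \<Rightarrow> real"
  assumes prob_dens: "\<And>i. prob_density_on (einterval (a i) (b i)) (f i)"
    and poincare: "\<And>i. weighted_poincare (einterval (a i) (b i)) (f i) (w i)"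
begin

abbreviation "I i \<equiv> einterval (a i) (b i)"
abbreviation "A \<equiv> open_box a b"
abbreviation "p \<equiv> product_density f"
abbreviation "\<mu> i \<equiv> density lborel (\<lambda>x. ennreal (f i x))"
abbreviation vec :: "('n \<Rightarrow> real) \<Rightarrow> real ^ 'n" where "vec y \<equiv> (\<chi> i. y i)"

lemma f_measurable [measurable]: "f i \<in> borel_measurable borel"
  and f_nonneg [simp]: "0 \<le> f i t"
  and f_outside: "t \<notin> I i \<Longrightarrow> f i t = 0"
  and prob_space_factor: "prob_space (\<mu> i)"
  using prob_dens[of i] by (auto simp: prob_density_on_def)

lemma w_nonneg: "t \<in> I i \<Longrightarrow> 0 \<le> w i t"
  using poincare[of i] by (simp add: weighted_poincare_def)

text \<open>The weight is only known on its interval, and likewise \<open>\<phi>\<close> and its derivatives only on the box.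
  All functions are therefore cut off by indicators before they are integrated.\<close>

lemma w_measurable [measurable]: "(\<lambda>t. indicator (I i) t * w i t) \<in> borel_measurable borel"
  using poincare[of i] borel_measurable_restrict_space_iff[of "I i" borel "w i"]
  by (simp add: weighted_poincare_def)

sublocale finite_product_prob_space \<mu> UNIV
  by (intro finite_product_prob_space.intro
    finite_product_sigma_finite.intro product_prob_space.intro product_sigma_finite.intro
    finite_product_sigma_finite_axioms.intro product_prob_space_axioms.intro)
    (auto simp: prob_space_factor prob_space_imp_sigma_finite)

lemma space_prod [simp]: "space \<P> = UNIV"
  by (auto simp: space_PiM)

lemma measurable_vec [measurable]: "vec \<in> \<P> \<rightarrow>\<^sub>M borel"
  by (rule measurable_vec_lambda) simp

lemma open_box_open [simp]: "open A"
proof -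
  have "A = (\<Inter>i. (\<lambda>x. x $ i) -` I i)" by (auto simp: open_box_def)
  then show ?thesis by (auto intro!: open_INT open_vimage continuous_intros)
qed

lemma box_measurable [measurable]: "A \<in> sets borel"
  by simp

lemma p_nonneg [simp]: "0 \<le> p x"
  by (simp add: product_density_def prod_nonneg)

lemma p_measurable [measurable]: "p \<in> borel_measurable borel"
  unfolding product_density_def by measurable

lemma p_outside: "x \<notin> A \<Longrightarrow> p x = 0"
  by (auto simp: open_box_def product_density_def prod_zero_iff) (metis f_outside)

lemma distr_vec: "distr \<P> borel vec = density lborel (\<lambda>x. ennreal (p x))"
  using distr_vec_density[of "\<lambda>i t. ennreal (f i t)"] prob_space_factor prob_space_imp_sigma_finite
  by (auto simp: product_density_def prod_ennreal)

lemma nn_integral_prod: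
  assumes [measurable]: "G \<in> borel_measurable borel"
  shows "(\<integral>\<^sup>+ y. G (vec y) \<partial>\<P>) = (\<integral>\<^sup>+ x. ennreal (p x) * G x \<partial>lborel)"
proof -
  have "(\<integral>\<^sup>+ y. G (vec y) \<partial>\<P>) = (\<integral>\<^sup>+ x. G x \<partial>distr \<P> borel vec)"
    by (simp add: nn_integral_distr)
  then show ?thesis by (simp add: distr_vec nn_integral_density)
qed

text \<open>Passage between the integrals over the box in \<open>real ^ 'n\<close> and integrals over the product
  probability space on functions.\<close>

lemma
  assumes [measurable]: "(\<lambda>x. indicator A x * g x) \<in> borel_measurable borel"
  shows integral_prod: "(\<integral>y. indicator A (vec y) * g (vec y) \<partial>\<P>) = (LINT x:A|lborel. g x * p x)"
    and integrable_prod: "integrable \<P> (\<lambda>y. indicator A (vec y) * g (vec y))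
      \<longleftrightarrow> set_integrable lborel A (\<lambda>x. g x * p x)"
proof -
  have commute: "indicator A x *\<^sub>R (g x * p x) = p x * (indicator A x * g x)" for x
    by simp
  have "(\<integral>y. indicator A (vec y) * g (vec y) \<partial>\<P>) = (\<integral>x. indicator A x * g x \<partial>distr \<P> borel vec)"
    by (subst integral_distr) auto
  also have "\<dots> = (LINT x:A|lborel. g x * p x)"
    unfolding distr_vec set_lebesgue_integral_def commute
    by (subst integral_real_density) auto
  finally show "(\<integral>y. indicator A (vec y) * g (vec y) \<partial>\<P>) = (LINT x:A|lborel. g x * p x)" .
  have "integrable \<P> (\<lambda>y. indicator A (vec y) * g (vec y))
      \<longleftrightarrow> integrable (distr \<P> borel vec) (\<lambda>x. indicator A x * g x)"
    by (subst integrable_distr_eq) auto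
  also have "\<dots> \<longleftrightarrow> set_integrable lborel A (\<lambda>x. g x * p x)"
    unfolding distr_vec set_integrable_def commute
    by (subst integrable_real_density) auto
  finally show "integrable \<P> (\<lambda>y. indicator A (vec y) * g (vec y))
      \<longleftrightarrow> set_integrable lborel A (\<lambda>x. g x * p x)" .
qed

lemma AE_in_box: "AE y in \<P>. vec y \<in> A"
proof -
  have "AE x in distr \<P> borel vec. x \<in> A"
    unfolding distr_vec by (subst AE_density) (use p_outside in \<open>force intro!: AE_I2\<close>)+
  then show ?thesis by (subst (asm) AE_distr_iff) auto
qed

definition on_box :: "(real ^ 'n \<Rightarrow> real) \<Rightarrow> ('n \<Rightarrow> real) \<Rightarrow> real" where
  "on_box \<phi> y = indicator A (vec y) * \<phi> (vec y)"

definition energy :: "(real ^ 'n \<Rightarrow> real) \<Rightarrow> 'n \<Rightarrow> real ^ 'n \<Rightarrow> real" where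
  "energy \<phi> i x = indicator A x * (w i (x $ i) * (partial_deriv i \<phi> x)\<^sup>2)"

lemma energy_nonneg [simp]: "0 \<le> energy \<phi> i x"
  by (auto simp: energy_def open_box_def indicator_def intro!: mult_nonneg_nonneg w_nonneg)

lemma smooth_indicator_measurable:
  "smooth_on \<phi> A \<Longrightarrow> (\<lambda>x. indicator A x * \<phi> x) \<in> borel_measurable borel"
  using borel_measurable_continuous_on_indicator[of A \<phi>] smooth_on_continuous[of \<phi> A] by simp

lemma on_box_measurable:
  assumes "smooth_on \<phi> A"
  shows "on_box \<phi> \<in> borel_measurable \<P>"
  unfolding on_box_def[abs_def]
  by (rule measurable_compose[OF measurable_vec smooth_indicator_measurable[OF assms]])

lemma energy_measurable [measurable]:
  assumes "smooth_on \<phi> A"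
  shows "energy \<phi> i \<in> borel_measurable borel"
proof -
  have [measurable]: "(\<lambda>x. indicator A x * frechet_derivative \<phi> (at x) (axis i 1)) \<in> borel_measurable borel"
    using borel_measurable_continuous_on_indicator[of A "\<lambda>x. frechet_derivative \<phi> (at x) (axis i 1)"]
      smooth_on_continuous_frechet_derivative[OF assms] by simp
  have "energy \<phi> i = (\<lambda>x. (indicator (I i) (x $ i) * w i (x $ i)) *
      (indicator A x * frechet_derivative \<phi> (at x) (axis i 1))\<^sup>2)"
    using partial_deriv_eq_frechet[OF smooth_on_differentiable[OF assms]]
    by (auto simp: energy_def fun_eq_iff indicator_def open_box_def)
  then show ?thesis by simp
qed

text \<open>The one-dimensional inequality, applied to \<open>\<phi>\<close> on a line parallel to axis \<open>i\<close>. Stating it with the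
  nonnegative integral on the right absorbs the lines on which the right-hand side is infinite, where
  the hypothesis says nothing. If another coordinate of \<open>y\<close> lies outside its interval, then the line
  misses the box and the section vanishes; hence no point \<open>y\<close> has to be excluded.\<close>

lemma section_variance_le:
  assumes smooth: "smooth_on \<phi> A" and bdd: "bounded (\<phi> ` A)"
  shows "ennreal (\<integral>t. (on_box \<phi> (y(i := t)) - (\<integral>s. on_box \<phi> (y(i := s)) \<partial>\<mu> i))\<^sup>2 \<partial>\<mu> i)
    \<le> (\<integral>\<^sup>+ t. ennreal (energy \<phi> i (vec (y(i := t)))) \<partial>\<mu> i)"
proof (cases "\<forall>j. j \<noteq> i \<longrightarrow> y j \<in> I j")
  case False
  then have "on_box \<phi> (y(i := t)) = 0" for t
    by (auto simp: on_box_def open_box_def indicator_def)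
  then show ?thesis by simp
next
  case True
  then have in_A: "vec (y(i := t)) \<in> A \<longleftrightarrow> t \<in> I i" for t
    by (auto simp: open_box_def)
  define \<psi> where "\<psi> t = \<phi> (vec (y(i := t)))" for t
  have line: "(\<chi> j. if j = i then t else vec y $ j) = vec (y(i := t))" for t
    by (simp add: vec_eq_iff)
  have smooth_\<psi>: "smooth_on \<psi> (I i)"
    using smooth_on_coord_line[OF smooth open_einterval, of "a i" "b i" i "vec y"] in_A
    unfolding \<psi>_def[abs_def] line by auto
  have bdd_\<psi>: "bounded (\<psi> ` I i)"
    by (rule bounded_subset[OF bdd]) (auto simp: \<psi>_def in_A simp del: fun_upd_apply)
  have deriv_\<psi>: "partial_deriv i \<phi> (vec (y(i := t))) = deriv \<psi> t" for t
  proof -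
    have same_line: "(\<chi> j. if j = i then s else vec (y(i := t)) $ j) = vec (y(i := s))" for s
      by (simp add: vec_eq_iff)
    show ?thesis unfolding partial_deriv_def \<psi>_def[abs_def] same_line by simp
  qed
  have [measurable]: "(\<lambda>t. indicator (I i) t * \<psi> t) \<in> borel_measurable borel"
      "(\<lambda>t. indicator (I i) t * deriv \<psi> t) \<in> borel_measurable borel"
    using borel_measurable_continuous_on_indicator[of "I i" \<psi>]
      borel_measurable_continuous_on_indicator[of "I i" "deriv \<psi>"]
      smooth_on_continuous[OF smooth_\<psi>] continuous_on_deriv_smooth[OF smooth_\<psi>] by auto
  define G where "G t = indicator (I i) t * (w i t * (deriv \<psi> t)\<^sup>2 * f i t)" for t
  have G_eq: "G = (\<lambda>t. (indicator (I i) t * w i t) * (indicator (I i) t * deriv \<psi> t)\<^sup>2 * f i t)"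
    by (auto simp: G_def fun_eq_iff indicator_def)
  have G_meas [measurable]: "G \<in> borel_measurable borel"
    unfolding G_eq by measurable
  have G_nonneg: "0 \<le> G t" for t
    by (auto simp: G_def indicator_def w_nonneg)
  have energy_eq: "energy \<phi> i (vec (y(i := t)))
      = (indicator (I i) t * w i t) * (indicator (I i) t * deriv \<psi> t)\<^sup>2" for t
    by (cases "t \<in> I i") (simp_all add: energy_def deriv_\<psi> in_A fun_upd_same del: fun_upd_apply)
  have "(\<integral>\<^sup>+ t. ennreal (energy \<phi> i (vec (y(i := t)))) \<partial>\<mu> i)
      = (\<integral>\<^sup>+ t. ennreal (f i t) * ennreal (energy \<phi> i (vec (y(i := t)))) \<partial>lborel)"
    unfolding energy_eq by (subst nn_integral_density) auto
  also have "\<dots> = (\<integral>\<^sup>+ t. ennreal (G t) \<partial>lborel)"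
    unfolding energy_eq G_eq
    by (intro nn_integral_cong) (auto simp: indicator_def w_nonneg mult_ac simp flip: ennreal_mult)
  finally have rhs: "(\<integral>\<^sup>+ t. ennreal (energy \<phi> i (vec (y(i := t)))) \<partial>\<mu> i) = (\<integral>\<^sup>+ t. ennreal (G t) \<partial>lborel)" .
  show ?thesis
  proof (cases "(\<integral>\<^sup>+ t. ennreal (G t) \<partial>lborel) = \<infinity>")
    case False
    then have int_G: "integrable lborel G"
      using G_nonneg by (intro integrableI_nonneg) (auto simp: top.not_eq_extremum)
    define c where "c = (LINT s:I i|lborel. \<psi> s * f i s)"
    have on_box_eq: "on_box \<phi> (y(i := t)) = indicator (I i) t * \<psi> t" for t
      by (cases "t \<in> I i") (simp_all add: on_box_def \<psi>_def in_A del: fun_upd_apply)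
    have mean: "(\<integral>s. on_box \<phi> (y(i := s)) \<partial>\<mu> i) = c"
      unfolding on_box_eq c_def set_lebesgue_integral_def
      by (subst integral_real_density) (auto intro!: Bochner_Integration.integral_cong)
    have weighted_square: "indicator (I i) t *\<^sub>R ((\<psi> t - c)\<^sup>2 * f i t)
        = f i t * (indicator (I i) t * \<psi> t - c)\<^sup>2" for t
      by (cases "t \<in> I i") (simp_all add: f_outside)
    have "(\<integral>t. (on_box \<phi> (y(i := t)) - c)\<^sup>2 \<partial>\<mu> i) = (LINT t:I i|lborel. (\<psi> t - c)\<^sup>2 * f i t)"
      unfolding on_box_eq set_lebesgue_integral_def weighted_square
      by (subst integral_real_density) auto
    also have "\<dots> \<le> (LINT t:I i|lborel. w i t * (deriv \<psi> t)\<^sup>2 * f i t)"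
      using poincare[of i] smooth_\<psi> bdd_\<psi> int_G
      by (simp add: weighted_poincare_def c_def set_integrable_def G_def[abs_def])
    also have "\<dots> = (\<integral>t. G t \<partial>lborel)"
      by (simp add: set_lebesgue_integral_def G_def)
    finally show ?thesis
      unfolding rhs mean using nn_integral_eq_integral[OF int_G] G_nonneg by (simp add: ennreal_leI)
  qed (simp add: rhs del: fun_upd_apply)
qed

text \<open>For bounded \<open>\<phi>\<close> the Efron-Stein inequality reduces the claim to the sections, and resampling
  coordinate \<open>i\<close> turns the averages over sections back into integrals over the product.\<close>

lemma bounded_variance_le:
  assumes smooth: "smooth_on \<phi> A" and bdd: "bounded (\<phi> ` A)"
  shows "ennreal ((\<integral>y. (on_box \<phi> y)\<^sup>2 \<partial>\<P>) - (\<integral>y. on_box \<phi> y \<partial>\<P>)\<^sup>2)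
    \<le> (\<Sum>i\<in>UNIV. \<integral>\<^sup>+ y. ennreal (energy \<phi> i (vec y)) \<partial>\<P>)"
proof -
  let ?h = "on_box \<phi>"
  obtain C where C: "\<And>x. x \<in> A \<Longrightarrow> \<bar>\<phi> x\<bar> \<le> C"
    using bdd by (auto simp: bounded_iff)
  have h: "bounded_rv ?h"
    by (rule bounded_rvI[OF on_box_measurable[OF smooth], of "\<bar>C\<bar>"])
      (auto simp: on_box_def indicator_def intro: order_trans[OF C])
  have "ennreal (\<integral>y. (?h y - coord_mean i ?h y)\<^sup>2 \<partial>\<P>)
      \<le> (\<integral>\<^sup>+ y. ennreal (energy \<phi> i (vec y)) \<partial>\<P>)" for i
  proof -
    let ?d = "\<lambda>y. (?h y - coord_mean i ?h y)\<^sup>2"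
    have d: "bounded_rv ?d"
      unfolding power2_eq_square
      by (intro bounded_rv_mult bounded_rv_diff bounded_rv_coord_mean h) auto
    have d': "bounded_rv (coord_mean i ?d)" by (rule bounded_rv_coord_mean[OF _ d]) simp
    have "ennreal (\<integral>y. ?d y \<partial>\<P>) = ennreal (\<integral>y. coord_mean i ?d y \<partial>\<P>)"
      by (simp add: integral_coord_mean[OF _ d])
    also have "\<dots> = (\<integral>\<^sup>+ y. ennreal (coord_mean i ?d y) \<partial>\<P>)"
      by (intro nn_integral_eq_integral[symmetric] integrable_bounded_rv d' AE_I2)
        (simp add: coord_mean_def)
    also have "\<dots> \<le> (\<integral>\<^sup>+ y. \<integral>\<^sup>+ t. ennreal (energy \<phi> i (vec (y(i := t)))) \<partial>\<mu> i \<partial>\<P>)"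
      using section_variance_le[OF smooth bdd]
      by (intro nn_integral_mono) (simp add: coord_mean_def)
    also have "\<dots> = (\<integral>\<^sup>+ y. ennreal (energy \<phi> i (vec y)) \<partial>\<P>)"
      by (rule nn_integral_resample[symmetric])
        (auto intro!: measurable_compose[OF measurable_vec] energy_measurable smooth)
    finally show ?thesis .
  qed
  then have "ennreal (\<Sum>i\<in>UNIV. \<integral>y. (?h y - coord_mean i ?h y)\<^sup>2 \<partial>\<P>)
      \<le> (\<Sum>i\<in>UNIV. \<integral>\<^sup>+ y. ennreal (energy \<phi> i (vec y)) \<partial>\<P>)"
    by (subst sum_ennreal[symmetric]) (auto intro: sum_mono simp del: sum_ennreal)
  with ennreal_leI[OF efron_stein[OF h]] show ?thesis
    by (rule order_trans)
qed

text \<open>The one-dimensional inequalities are only available for bounded functions, so \<open>\<phi>\<close> is replaced by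
  \<open>soft_cut k \<phi>\<close>, whose energy is at most that of \<open>\<phi>\<close>. The variances converge by dominated
  convergence.\<close>

lemma variance_le:
  assumes smooth: "smooth_on \<phi> A"
    and int: "integrable \<P> (on_box \<phi>)" and int2: "integrable \<P> (\<lambda>y. (on_box \<phi> y)\<^sup>2)"
  shows "ennreal ((\<integral>y. (on_box \<phi> y)\<^sup>2 \<partial>\<P>) - (\<integral>y. on_box \<phi> y \<partial>\<P>)\<^sup>2)
    \<le> (\<Sum>i\<in>UNIV. \<integral>\<^sup>+ y. ennreal (energy \<phi> i (vec y)) \<partial>\<P>)"
proof -
  define \<phi>' where "\<phi>' k x = soft_cut (real (Suc k)) (\<phi> x)" for k x
  have smooth': "smooth_on (\<phi>' k) A" for k
    unfolding \<phi>'_def[abs_def] by (intro smooth_on_soft_cut smooth) simp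
  have bdd': "bounded (\<phi>' k ` A)" for k
    using abs_soft_cut_bounded[of "real (Suc k)" "\<phi> x" for x]
    by (intro boundedI[of _ "real (Suc k) * (pi / 2)"]) (auto simp: \<phi>'_def simp del: of_nat_Suc)
  have on_box': "on_box (\<phi>' k) y = soft_cut (real (Suc k)) (on_box \<phi> y)" for k y
    by (simp add: on_box_def \<phi>'_def indicator_def soft_cut_def)
  have on_box'_measurable: "(\<lambda>y. soft_cut (real (Suc k)) (on_box \<phi> y)) \<in> borel_measurable \<P>" for k
    unfolding on_box'[symmetric] by (rule on_box_measurable[OF smooth'])
  have energy': "energy (\<phi>' k) i x \<le> energy \<phi> i x" for k i x
  proof (cases "x \<in> A")
    case True
    then have "(partial_deriv i (\<phi>' k) x)\<^sup>2 \<le> (partial_deriv i \<phi> x)\<^sup>2"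
      unfolding \<phi>'_def[abs_def] abs_le_square_iff[symmetric]
      by (intro abs_partial_deriv_soft_cut_le smooth_on_differentiable[OF smooth]) auto
    with True show ?thesis
      by (auto simp: energy_def open_box_def intro!: mult_left_mono w_nonneg)
  qed (simp add: energy_def)
  have "(\<lambda>k. \<integral>y. on_box (\<phi>' k) y \<partial>\<P>) \<longlonglongrightarrow> (\<integral>y. on_box \<phi> y \<partial>\<P>)"
    by (rule integral_dominated_convergence[where w = "\<lambda>y. \<bar>on_box \<phi> y\<bar>"])
      (use int abs_soft_cut_le in \<open>auto intro!: AE_I2 on_box_measurable smooth on_box'_measurable soft_cut_tendsto
        simp: on_box' simp del: of_nat_Suc\<close>)
  moreover have "(\<lambda>k. \<integral>y. (on_box (\<phi>' k) y)\<^sup>2 \<partial>\<P>) \<longlonglongrightarrow> (\<integral>y. (on_box \<phi> y)\<^sup>2 \<partial>\<P>)"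
    by (rule integral_dominated_convergence[where w = "\<lambda>y. (on_box \<phi> y)\<^sup>2"])
      (use int2 abs_soft_cut_le in \<open>auto intro!: AE_I2 borel_measurable_power on_box_measurable smooth on_box'_measurable
        tendsto_power soft_cut_tendsto simp: on_box' abs_le_square_iff[symmetric] simp del: of_nat_Suc\<close>)
  ultimately have "(\<lambda>k. ennreal ((\<integral>y. (on_box (\<phi>' k) y)\<^sup>2 \<partial>\<P>) - (\<integral>y. on_box (\<phi>' k) y \<partial>\<P>)\<^sup>2))
      \<longlonglongrightarrow> ennreal ((\<integral>y. (on_box \<phi> y)\<^sup>2 \<partial>\<P>) - (\<integral>y. on_box \<phi> y \<partial>\<P>)\<^sup>2)"
    by (intro tendsto_ennrealI tendsto_diff tendsto_power)
  moreover have "ennreal ((\<integral>y. (on_box (\<phi>' k) y)\<^sup>2 \<partial>\<P>) - (\<integral>y. on_box (\<phi>' k) y \<partial>\<P>)\<^sup>2)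
      \<le> (\<Sum>i\<in>UNIV. \<integral>\<^sup>+ y. ennreal (energy \<phi> i (vec y)) \<partial>\<P>)" for k
    using energy' by (intro order_trans[OF bounded_variance_le[OF smooth' bdd']] sum_mono
        nn_integral_mono ennreal_leI)
  ultimately show ?thesis
    by (intro LIMSEQ_le_const2) auto
qed

lemma box_poincare:
  assumes smooth: "smooth_on \<phi> A" and var: "has_finite_variance A p \<phi>"
    and finite: "set_integrable lborel A (\<lambda>x. (\<Sum>i\<in>UNIV. w i (x $ i) * (partial_deriv i \<phi> x)\<^sup>2) * p x)"
  shows "(LINT x:A|lborel. (\<phi> x - (LINT y:A|lborel. \<phi> y * p y))\<^sup>2 * p x)
    \<le> (LINT x:A|lborel. (\<Sum>i\<in>UNIV. w i (x $ i) * (partial_deriv i \<phi> x)\<^sup>2) * p x)"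
proof -
  let ?h = "on_box \<phi>"
  define m where "m = (LINT y:A|lborel. \<phi> y * p y)"
  note [measurable] = smooth_indicator_measurable[OF smooth] on_box_measurable[OF smooth]
  have int: "integrable \<P> ?h" and mean: "(\<integral>y. ?h y \<partial>\<P>) = m"
    using var integrable_prod[of \<phi>] integral_prod[of \<phi>]
    by (auto simp: has_finite_variance_def on_box_def[abs_def] m_def)
  have "(\<lambda>x. indicator A x * (\<phi> x - m)\<^sup>2) = (\<lambda>x. indicator A x * (indicator A x * \<phi> x - m)\<^sup>2)"
    by (auto simp: fun_eq_iff indicator_def)
  then have [measurable]: "(\<lambda>x. indicator A x * (\<phi> x - m)\<^sup>2) \<in> borel_measurable borel"
    by simp
  have ae: "AE y in \<P>. indicator A (vec y) * (\<phi> (vec y) - m)\<^sup>2 = (?h y - m)\<^sup>2"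
    using AE_in_box by eventually_elim (simp add: on_box_def)
  have "integrable \<P> (\<lambda>y. indicator A (vec y) * (\<phi> (vec y) - m)\<^sup>2)"
    using var integrable_prod[of "\<lambda>x. (\<phi> x - m)\<^sup>2"] 
    by (simp add: has_finite_variance_def flip: m_def)
  then have int_centred: "integrable \<P> (\<lambda>y. (?h y - m)\<^sup>2)"
    by (rule integrable_cong_AE_imp) (use ae in auto)
  \<comment> \<open>Finite variance together with a finite mean gives a finite second moment.\<close>
  have "integrable \<P> (\<lambda>y. (?h y - m)\<^sup>2 + 2 * m * ?h y - m\<^sup>2)"
    using int int_centred by auto
  then have int2: "integrable \<P> (\<lambda>y. (?h y)\<^sup>2)"
    by (simp add: power2_diff)
  have "(LINT x:A|lborel. (\<phi> x - m)\<^sup>2 * p x) = (\<integral>y. (?h y - m)\<^sup>2 \<partial>\<P>)"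
    unfolding integral_prod[of "\<lambda>x. (\<phi> x - m)\<^sup>2", symmetric, simplified]
    by (rule integral_cong_AE) (use ae in auto)
  also have "\<dots> = (\<integral>y. (?h y)\<^sup>2 \<partial>\<P>) - (\<integral>y. ?h y \<partial>\<P>)\<^sup>2"
    using P.variance_eq[OF int int2] by (simp add: mean)
  finally have lhs: "(LINT x:A|lborel. (\<phi> x - m)\<^sup>2 * p x) = (\<integral>y. (?h y)\<^sup>2 \<partial>\<P>) - (\<integral>y. ?h y \<partial>\<P>)\<^sup>2" .
  have energy_sum: "indicator A x *\<^sub>R ((\<Sum>i\<in>UNIV. w i (x $ i) * (partial_deriv i \<phi> x)\<^sup>2) * p x)
      = p x * (\<Sum>i\<in>UNIV. energy \<phi> i x)" for x
    by (auto simp: energy_def indicator_def)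
  then have rhs: "(LINT x:A|lborel. (\<Sum>i\<in>UNIV. w i (x $ i) * (partial_deriv i \<phi> x)\<^sup>2) * p x)
      = (\<integral>x. p x * (\<Sum>i\<in>UNIV. energy \<phi> i x) \<partial>lborel)"
    by (simp only: set_lebesgue_integral_def)
  have int_energy: "integrable lborel (\<lambda>x. p x * (\<Sum>i\<in>UNIV. energy \<phi> i x))"
    using finite unfolding set_integrable_def energy_sum .
  have "(\<Sum>i\<in>UNIV. \<integral>\<^sup>+ y. ennreal (energy \<phi> i (vec y)) \<partial>\<P>)
      = (\<integral>\<^sup>+ y. ennreal (\<Sum>i\<in>UNIV. energy \<phi> i (vec y)) \<partial>\<P>)"
    using energy_measurable[OF smooth] by (subst nn_integral_sum[symmetric]) auto
  also have "\<dots> = (\<integral>\<^sup>+ x. ennreal (p x * (\<Sum>i\<in>UNIV. energy \<phi> i x)) \<partial>lborel)"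
    using nn_integral_prod[of "\<lambda>x. ennreal (\<Sum>i\<in>UNIV. energy \<phi> i x)"] energy_measurable[OF smooth]
    by (simp add: ennreal_mult sum_nonneg)
  also have "\<dots> = ennreal (\<integral>x. p x * (\<Sum>i\<in>UNIV. energy \<phi> i x) \<partial>lborel)"
    by (intro nn_integral_eq_integral int_energy AE_I2) (simp add: sum_nonneg)
  finally show ?thesis
    using variance_le[OF smooth int int2] unfolding m_def[symmetric] lhs rhs
    by (simp add: ennreal_le_iff integral_nonneg_AE sum_nonneg)
qed

end

theorem theorem8:
  fixes a b :: "'n::finite \<Rightarrow> ereal"
    and f w :: "'n \<Rightarrow> real \<Rightarrow> real"
    and \<phi> :: "real ^ 'n \<Rightarrow> real"
  defines "A \<equiv> open_box a b"
    and "p \<equiv> product_density f"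
  assumes "\<And>i. a i < b i"
    and "\<And>i. prob_density_on (einterval (a i) (b i)) (f i)"
    and "\<And>i. set_integrable lborel (einterval (a i) (b i)) (\<lambda>x. x * f i x)"
    and "\<And>i. weighted_poincare (einterval (a i) (b i)) (f i) (w i)"
    and "smooth_on \<phi> A"
    and "has_finite_variance A p \<phi>"
    and "set_integrable lborel A
           (\<lambda>x. (\<Sum>i\<in>UNIV. w i (x $ i) * (partial_deriv i \<phi> x)\<^sup>2) * p x)"
  shows "(LINT x:A|lborel. (\<phi> x - (LINT y:A|lborel. \<phi> y * p y))\<^sup>2 * p x)
           \<le> (LINT x:A|lborel. (\<Sum>i\<in>UNIV. w i (x $ i) * (partial_deriv i \<phi> x)\<^sup>2) * p x)"
proof -
  interpret poincare_product a b f w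
    using assms(4,6) by unfold_locales
  show ?thesis
    using box_poincare assms(7-9) unfolding A_def p_def by blast
qed

end
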